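(* Identify $\mathbb R^2$ with $\mathbb C$ and let $E$ be the self-similar set generated by the IFS $\{f_i\}_{i=1}^7$, where $$f_1(z)=\tfrac{2z}{3},\quad f_2(z)=\tfrac z3+\tfrac{2\mathbf i}{3},\quad f_3(z)=\tfrac z3+\tfrac{1+2\mathbf i}{3},\quad f_4(z)=\tfrac z6+\tfrac{4+5\mathbf i}{6},$$ $$f_5(z)=\tfrac z6+\tfrac{5+5\mathbf i}{6},\quad f_6(z)=\tfrac z3+\tfrac{2+\mathbf i}{3},\quad f_7(z)=\tfrac z{12}+\tfrac{22+17\mathbf i}{24}.$$ Let $L=\{1\}\times[1/2,1]$. If $x$ is a trivial point of $E$, then $x\in L$.
   Context: $\mathbf i$ is the imaginary unit. The self-similar set generated by $\{f_i\}_{i=1}^7$ is the unique nonempty compact set $E\subset\mathbb C$ with $E=\bigcup_{i=1}^7f_i(E)$. A trivial point of $E$ is a point whose connected component in $E$ is a singleton. Under the identification, $L=\{1+t\mathbf i: 1/2\le t\le 1\}$. *)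

theory Defs
  imports "HOL-Analysis.Analysis"
begin

definition is_self_similar_set :: "('a \<Rightarrow> 'a) set \<Rightarrow> 'a::metric_space set \<Rightarrow> bool" where
  "is_self_similar_set F E \<longleftrightarrow> E \<noteq> {} \<and> compact E \<and> E = (\<Union>f\<in>F. f ` E)"

(* The description is meaningful for finite nonempty systems of contractions,
   see ex1_self_similar_set below. *)
definition self_similar_set :: "('a \<Rightarrow> 'a) set \<Rightarrow> 'a::metric_space set" where
  "self_similar_set F = (THE E. is_self_similar_set F E)"

definition trivial_point :: "'a::topological_space set \<Rightarrow> 'a \<Rightarrow> bool" where
  "trivial_point E x \<longleftrightarrow> x \<in> E \<and> connected_component_set E x = {x}"

definition IFS :: "(complex \<Rightarrow> complex) set" where
  "IFS = {\<lambda>z. 2 * z / 3,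
          \<lambda>z. z / 3 + 2 * \<i> / 3,
          \<lambda>z. z / 3 + (1 + 2 * \<i>) / 3,
          \<lambda>z. z / 6 + (4 + 5 * \<i>) / 6,
          \<lambda>z. z / 6 + (5 + 5 * \<i>) / 6,
          \<lambda>z. z / 3 + (2 + \<i>) / 3,
          \<lambda>z. z / 12 + (22 + 17 * \<i>) / 24}"

definition L :: "complex set" where
  "L = {Complex 1 t | t. 1/2 \<le> t \<and> t \<le> 1}"

lemma self_similar_set_subset:
  fixes E E' :: "'a::heine_borel set"
  assumes c: "0 \<le> c" "c < 1"
    and lip: "\<And>f x y. f \<in> F \<Longrightarrow> dist (f x) (f y) \<le> c * dist x y"
    and E: "is_self_similar_set F E" and E': "is_self_similar_set F E'"
  shows "E \<subseteq> E'"
proof -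
  have ne: "E \<noteq> {}" "E' \<noteq> {}" and cp: "compact E" "compact E'"
    and inv: "E = (\<Union>f\<in>F. f ` E)" "E' = (\<Union>f\<in>F. f ` E')"
    using E E' by (auto simp only: is_self_similar_set_def)
  obtain x where x: "x \<in> E" "\<And>y. y \<in> E \<Longrightarrow> infdist y E' \<le> infdist x E'"
    using continuous_attains_sup[OF cp(1) ne(1), of "\<lambda>y. infdist y E'"]
    using continuous_on_infdist[OF continuous_on_id, of E E'] by auto
  obtain f y where f: "f \<in> F" "y \<in> E" "x = f y"
    using x(1) inv(1) by blast
  obtain y' where y': "y' \<in> E'" "infdist y E' = dist y y'"
    using infdist_attains_inf[OF compact_imp_closed[OF cp(2)] ne(2)] by metis
  have "f y' \<in> E'" using f(1) y'(1) inv(2) by blast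
  then have "infdist x E' \<le> dist (f y) (f y')"
    using f(3) by (simp add: infdist_le)
  also have "\<dots> \<le> c * infdist y E'" using lip f(1) y'(2) by simp
  also have "\<dots> \<le> c * infdist x E'" using x(2)[OF f(2)] c(1) by (rule mult_left_mono)
  finally have "(1 - c) * infdist x E' \<le> 0" by (simp add: algebra_simps)
  then have "infdist x E' \<le> 0" using c(2) by (simp add: mult_le_0_iff)
  then have "infdist z E' = 0" if "z \<in> E" for z
    using x(2)[OF that] infdist_nonneg[of z E'] by linarith
  then show ?thesis
    using in_closed_iff_infdist_zero[OF compact_imp_closed[OF cp(2)] ne(2)] by blast
qed

lemma self_similar_set_exists:
  fixes F :: "('a::heine_borel \<Rightarrow> 'a) set"
  assumes F: "finite F" "F \<noteq> {}" and c: "0 \<le> c" "c < 1"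
    and lip: "\<And>f x y. f \<in> F \<Longrightarrow> dist (f x) (f y) \<le> c * dist x y"
  shows "\<exists>E. is_self_similar_set F E"
proof -
  define a :: 'a where "a = undefined"
  define M where "M = Max ((\<lambda>f. dist (f a) a) ` F)"
  have M: "dist (f a) a \<le> M" if "f \<in> F" for f using F that by (auto simp: M_def)
  have M0: "0 \<le> M" using F(2) M by (meson all_not_in_conv order_trans zero_le_dist)
  define R where "R = M / (1 - c)"
  have R: "c * R + M = R" using c by (simp add: R_def field_simps)
  have R0: "0 \<le> R" using c M0 by (simp add: R_def)
  define H where "H A = (\<Union>f\<in>F. f ` A)" for A
  have mono: "H A \<subseteq> H B" if "A \<subseteq> B" for A B using that by (auto simp: H_def)
  have cont: "continuous_on A f" if "f \<in> F" for f and A :: "'a set"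
    by (rule lipschitz_on_continuous_on[of c]) (use c lip that in \<open>auto intro: lipschitz_onI\<close>)
  define K where "K n = (H ^^ n) (cball a R)" for n
  have KS: "K (Suc n) = H (K n)" for n by (simp add: K_def)
  have base: "H (cball a R) \<subseteq> cball a R"
  proof -
    have "dist a (f z) \<le> R" if "f \<in> F" "dist a z \<le> R" for f z
    proof -
      have "dist a (f z) \<le> dist (f a) a + dist (f a) (f z)" by (simp add: dist_triangle3)
      also have "\<dots> \<le> M + c * dist a z" using M lip that(1) by (intro add_mono) auto
      also have "\<dots> \<le> M + c * R" using that(2) c(1) by (simp add: mult_left_mono)
      finally show ?thesis using R by simp
    qed
    then show ?thesis by (auto simp: H_def)
  qed
  have dec1: "K (Suc n) \<subseteq> K n" for n
  proof (induction n)
    case 0 show ?case using base by (simp add: K_def)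
  next
    case (Suc n) then show ?case using mono by (simp only: KS)
  qed
  have dec: "m \<le> n \<Longrightarrow> K n \<subseteq> K m" for m n
    by (rule lift_Suc_antimono_le[of K]) (use dec1 in auto)
  have cpK: "compact (K n) \<and> K n \<noteq> {}" for n
  proof (induction n)
    case 0 show ?case using R0 by (auto simp: K_def)
  next
    case (Suc n)
    have "compact (H (K n))" unfolding H_def
      using F Suc cont by (intro compact_UN) (auto intro!: compact_continuous_image)
    moreover have "H (K n) \<noteq> {}" using F(2) Suc by (auto simp: H_def)
    ultimately show ?case by (simp add: KS)
  qed
  define E where "E = (\<Inter>n. K n)"
  have ne: "E \<noteq> {}" unfolding E_def using cpK dec by (intro compact_nest) auto
  have cp: "compact E" unfolding E_def
    by (rule compact_Inter) (use cpK in auto)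
  have "H E \<subseteq> K n" for n
  proof (cases n)
    case 0 then show ?thesis using mono[of E "K 0"] dec1[of 0] by (auto simp: E_def KS)
  next
    case (Suc m) then show ?thesis using mono[of E "K m"] by (auto simp: E_def KS)
  qed
  then have 1: "H E \<subseteq> E" by (auto simp: E_def)
  have 2: "E \<subseteq> H E"
  proof
    fix x assume x: "x \<in> E"
    define A where "A n = (\<Union>f\<in>F. {y \<in> K n. f y = x})" for n
    have "compact (A n)" for n
    proof -
      have "closed {y \<in> K n. f y = x}" if "f \<in> F" for f
        using continuous_closed_preimage_constant[OF cont[OF that] compact_imp_closed] cpK by blast
      then have "compact (K n \<inter> {y \<in> K n. f y = x})" if "f \<in> F" for f
        using cpK that by (intro compact_Int_closed) auto
      moreover have "K n \<inter> {y \<in> K n. f y = x} = {y \<in> K n. f y = x}" for f by auto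
      ultimately show ?thesis unfolding A_def using F(1) by (intro compact_UN) auto
    qed
    moreover have "A n \<noteq> {}" for n
    proof -
      have "x \<in> H (K n)" using x KS[of n] by (auto simp: E_def simp del: INT_iff dest: INT_D[of _ K _ "Suc n"])
      then show ?thesis by (auto simp: H_def A_def)
    qed
    moreover have "A n \<subseteq> A m" if "m \<le> n" for m n using dec[OF that] by (auto simp: A_def)
    ultimately have "(\<Inter>n. A n) \<noteq> {}" by (intro compact_nest) auto
    then obtain y where y: "\<And>n. y \<in> A n" by auto
    then have "y \<in> E" by (auto simp: A_def E_def)
    moreover obtain f where "f \<in> F" "f y = x" using y[of 0] by (auto simp: A_def)
    ultimately show "x \<in> H E" by (auto simp: H_def)
  qed
  have "is_self_similar_set F E"
    unfolding is_self_similar_set_def using ne cp 1 2 by (auto simp only: H_def)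
  then show ?thesis by blast
qed

theorem ex1_self_similar_set:
  fixes F :: "('a::heine_borel \<Rightarrow> 'a) set"
  assumes "finite F" "F \<noteq> {}" "0 \<le> c" "c < 1"
    and "\<And>f x y. f \<in> F \<Longrightarrow> dist (f x) (f y) \<le> c * dist x y"
  shows "\<exists>!E. is_self_similar_set F E"
proof -
  obtain E where E: "is_self_similar_set F E"
    using self_similar_set_exists[OF assms] by blast
  moreover have "E' = E" if "is_self_similar_set F E'" for E'
    using self_similar_set_subset[OF assms(3-5)] E that by (meson subset_antisym)
  ultimately show ?thesis by blast
qed

lemma IFS_contraction:
  assumes "f \<in> IFS"
  shows "dist (f x) (f y) \<le> 2/3 * dist x y"
proof -
  have aff: "dist (r * x + b) (r * y + b) \<le> 2/3 * dist x y" if "norm r \<le> 2/3" for r b :: complex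
  proof -
    have "dist (r * x + b) (r * y + b) = norm r * dist x y"
      by (simp add: dist_norm norm_mult flip: right_diff_distrib)
    then show ?thesis using mult_right_mono[OF that zero_le_dist] by metis
  qed
  show ?thesis
    using assms aff[of "2/3" 0] aff[of "1/3"] aff[of "1/6"] aff[of "1/12"]
    unfolding IFS_def by auto
qed

corollary is_self_similar_set_IFS: "is_self_similar_set IFS (self_similar_set IFS)"
  unfolding self_similar_set_def
  by (rule theI', rule ex1_self_similar_set[of _ "2/3"])
    (use IFS_contraction in \<open>auto simp: IFS_def\<close>)

end

theory Submission
  imports Defs
begin

text \<open>
  Write \<open>f\<^sub>1, \<dots>, f\<^sub>7\<close> for the seven maps, in the order of \<^const>\<open>IFS\<close>. All of them are homotheties
  with positive ratio that keep the unit square inside itself.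

  The union \<open>corner\<close> of the left and the top edge of the unit square is covered by its own images
  under the maps, hence lies in the attractor; call \<open>hub\<close> the component of the attractor that
  contains it. For \<open>k \<le> 6\<close> the copy \<open>f\<^sub>k(corner)\<close> touches \<open>corner\<close> or \<open>f\<^sub>1(corner)\<close>, so it lies in the
  hub. The copy \<open>f\<^sub>7(corner)\<close> is isolated from these, but it has an end point on \<^const>\<open>L\<close>. Two facts
  about \<open>L\<close> compensate for this: \<open>f\<^sub>5, f\<^sub>6, f\<^sub>7\<close> map \<open>L\<close> into itself, while \<open>f\<^sub>1, f\<^sub>2, f\<^sub>3, f\<^sub>4\<close> map
  \<open>L\<close> into the left edges of the copies under \<open>f\<^sub>6, f\<^sub>3, f\<^sub>4, f\<^sub>5\<close> respectively, hence into the hub.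

  Consequently the set of points of the attractor whose component meets \<open>corner \<union> L\<close> is mapped into
  itself by all seven maps, and so it is dense in the attractor
  (\<open>attractor_subset_closure_anchored\<close>). For \<open>k \<le> 4\<close> the map \<open>f\<^sub>k\<close> sends every such point into the
  hub, because it sends \<open>corner\<close> and \<open>L\<close> there. As the hub is closed, \<open>f\<^sub>k\<close> maps the whole attractor
  into the hub (\<open>glued_image_subset_hub\<close>), and no point of the hub is trivial.

  A trivial point \<open>x\<close> is therefore \<open>f\<^sub>k(y)\<close> with \<open>k \<in> {5,6,7}\<close>, and \<open>y\<close> is again trivial. So the set
  of trivial points is covered by its images under three contractions which preserve the closed set
  \<open>L\<close>, and it is contained in \<open>L\<close>.

  The arguments \<open>corner \<subseteq> attractor\<close>, density and the last step are all instances of one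
  principle, \<open>self_covered_subset_closure_invariant\<close>.
\<close>

section \<open>Sets covered by their images under contractions\<close>

text \<open>The distance to \<open>B\<close> is bounded on \<open>A\<close>. Going from a point of \<open>A\<close> back to a preimage in \<open>A\<close>
  shows that this bound can be improved by the factor \<open>c\<close>, hence by every power of \<open>c\<close>.\<close>

lemma self_covered_subset_closure_invariant:
  fixes A B :: "'a::metric_space set"
  assumes c: "0 \<le> c" "c < 1"
    and lip: "\<And>f x y. f \<in> F \<Longrightarrow> dist (f x) (f y) \<le> c * dist x y"
    and A: "bounded A" "A \<subseteq> (\<Union>f\<in>F. f ` A)"
    and B: "B \<noteq> {}" "\<And>f. f \<in> F \<Longrightarrow> f ` B \<subseteq> B"
  shows "A \<subseteq> closure B"
proof -
  obtain b where b: "b \<in> B" using B(1) by blast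
  obtain M where M: "\<And>x. x \<in> A \<Longrightarrow> dist b x \<le> M"
    using A(1) bounded_any_center[of A b] by blast
  have shrink: "infdist (f y) B \<le> c * infdist y B" if f: "f \<in> F" for f y
  proof (rule field_le_epsilon)
    fix e :: real assume e: "e > 0"
    have "(INF z\<in>B. dist y z) < infdist y B + e"
      using B(1) e by (simp add: infdist_notempty)
    then obtain z where z: "z \<in> B" "dist y z < infdist y B + e"
      using B(1) by (auto simp: cINF_less_iff)
    have "infdist (f y) B \<le> dist (f y) (f z)"
      using B(2)[OF f] z(1) by (intro infdist_le) auto
    also have "\<dots> \<le> c * dist y z" using lip[OF f] .
    also have "\<dots> \<le> c * (infdist y B + e)"
      using z(2) c(1) by (intro mult_left_mono) auto
    also have "\<dots> \<le> c * infdist y B + e"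
      using c e mult_right_mono[of c 1 e] by (simp add: algebra_simps)
    finally show "infdist (f y) B \<le> c * infdist y B + e" .
  qed
  have bound: "x \<in> A \<Longrightarrow> infdist x B \<le> c ^ n * M" for n x
  proof (induction n arbitrary: x)
    case 0
    have "infdist x B \<le> dist x b" using b by (rule infdist_le)
    then show ?case using M[OF 0] by (simp add: dist_commute)
  next
    case (Suc n)
    obtain f y where fy: "f \<in> F" "y \<in> A" "x = f y" using A(2) Suc.prems by blast
    have "infdist x B \<le> c * infdist y B" using shrink fy(1,3) by simp
    also have "\<dots> \<le> c * (c ^ n * M)" using Suc.IH[OF fy(2)] c(1) by (rule mult_left_mono)
    finally show ?case by simp
  qed
  have "(\<lambda>n. c ^ n * M) \<longlonglongrightarrow> 0"
    using c by (intro tendsto_mult_left_zero LIMSEQ_realpow_zero) auto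
  then have "infdist x B \<le> 0" if "x \<in> A" for x
    by (rule LIMSEQ_le_const) (use bound[OF that] in auto)
  then show ?thesis
    using in_closure_iff_infdist_zero[OF B(1)] infdist_nonneg by (meson antisym subsetI)
qed

section \<open>The maps in coordinates\<close>

definition homothety :: "real \<Rightarrow> real \<Rightarrow> real \<Rightarrow> complex \<Rightarrow> complex" where
  "homothety r a b z = Complex (r * Re z + a) (r * Im z + b)"

lemma Re_homothety [simp]: "Re (homothety r a b z) = r * Re z + a"
  and Im_homothety [simp]: "Im (homothety r a b z) = r * Im z + b"
  by (simp_all add: homothety_def)

text \<open>The maps \<open>f\<^sub>1, f\<^sub>2, f\<^sub>3, f\<^sub>4\<close>: the right edge of their copy of the unit square, or at least its
  upper half, is also the left edge of another copy.\<close>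

definition glued_maps :: "(complex \<Rightarrow> complex) set" where
  "glued_maps = {homothety (2/3) 0 0, homothety (1/3) 0 (2/3),
     homothety (1/3) (1/3) (2/3), homothety (1/6) (2/3) (5/6)}"

text \<open>The maps \<open>f\<^sub>5, f\<^sub>6, f\<^sub>7\<close>, which preserve \<^const>\<open>L\<close>.\<close>

definition right_maps :: "(complex \<Rightarrow> complex) set" where
  "right_maps = {homothety (1/6) (5/6) (5/6), homothety (1/3) (2/3) (1/3),
     homothety (1/12) (11/12) (17/24)}"

lemma IFS_eq: "IFS = glued_maps \<union> right_maps"
proof -
  have "(\<lambda>z. 2 * z / 3) = homothety (2/3) 0 0"
    "(\<lambda>z. z / 3 + 2 * \<i> / 3) = homothety (1/3) 0 (2/3)"
    "(\<lambda>z. z / 3 + (1 + 2 * \<i>) / 3) = homothety (1/3) (1/3) (2/3)"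
    "(\<lambda>z. z / 6 + (4 + 5 * \<i>) / 6) = homothety (1/6) (2/3) (5/6)"
    "(\<lambda>z. z / 6 + (5 + 5 * \<i>) / 6) = homothety (1/6) (5/6) (5/6)"
    "(\<lambda>z. z / 3 + (2 + \<i>) / 3) = homothety (1/3) (2/3) (1/3)"
    "(\<lambda>z. z / 12 + (22 + 17 * \<i>) / 24) = homothety (1/12) (11/12) (17/24)"
    by (auto simp: fun_eq_iff complex_eq_iff)
  then show ?thesis unfolding IFS_def glued_maps_def right_maps_def by auto
qed

lemma continuous_on_IFS: "f \<in> IFS \<Longrightarrow> continuous_on A f"
  by (rule lipschitz_on_continuous_on[of "2/3"]) (auto intro!: lipschitz_onI IFS_contraction)

lemma inj_IFS: "f \<in> IFS \<Longrightarrow> inj f"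
  by (auto simp: IFS_eq glued_maps_def right_maps_def inj_def complex_eq_iff)

lemma mem_L_iff: "z \<in> L \<longleftrightarrow> Re z = 1 \<and> 1/2 \<le> Im z \<and> Im z \<le> 1"
  by (auto simp: L_def complex_eq_iff)

lemma L_eq_cbox: "L = cbox (Complex 1 (1/2)) (Complex 1 1)"
  by (auto simp: mem_L_iff in_cbox_complex_iff)

lemma right_maps_preserve_L: "f \<in> right_maps \<Longrightarrow> f ` L \<subseteq> L"
  by (auto simp: right_maps_def mem_L_iff)

section \<open>The corner and its component\<close>

abbreviation attractor :: "complex set" where
  "attractor \<equiv> self_similar_set IFS"

lemma compact_attractor: "compact attractor"
  and attractor_nonempty: "attractor \<noteq> {}"
  and attractor_eq: "attractor = (\<Union>f\<in>IFS. f ` attractor)"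
  using is_self_similar_set_IFS unfolding is_self_similar_set_def by blast+

lemma IFS_image_attractor: "f \<in> IFS \<Longrightarrow> f ` attractor \<subseteq> attractor"
  using attractor_eq by blast

definition corner :: "complex set" where
  "corner = cbox 0 \<i> \<union> cbox \<i> (1 + \<i>)"

lemma mem_corner_iff:
  "z \<in> corner \<longleftrightarrow> Re z = 0 \<and> 0 \<le> Im z \<and> Im z \<le> 1 \<or> Im z = 1 \<and> 0 \<le> Re z \<and> Re z \<le> 1"
  by (auto simp: corner_def in_cbox_complex_iff)

lemma connected_corner: "connected corner"
proof -
  have "\<i> \<in> cbox 0 \<i> \<inter> cbox \<i> (1 + \<i>)" by (auto simp: in_cbox_complex_iff)
  then show ?thesis
    unfolding corner_def by (intro connected_Un convex_connected convex_box) auto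
qed

lemma homothety_image_corner:
  assumes "r > 0"
  shows "homothety r a b ` corner =
    {z. Re z = a \<and> b \<le> Im z \<and> Im z \<le> b + r \<or> Im z = b + r \<and> a \<le> Re z \<and> Re z \<le> a + r}"
    (is "_ = ?R")
proof
  show "homothety r a b ` corner \<subseteq> ?R"
    using assms by (auto simp: mem_corner_iff mult_left_le)
  show "?R \<subseteq> homothety r a b ` corner"
  proof
    fix z assume "z \<in> ?R"
    moreover have "z = homothety r a b (Complex ((Re z - a) / r) ((Im z - b) / r))"
      using assms by (simp add: complex_eq_iff)
    moreover have "Complex ((Re z - a) / r) ((Im z - b) / r) \<in> corner" if "z \<in> ?R"
      using assms that by (auto simp: mem_corner_iff field_simps)
    ultimately show "z \<in> homothety r a b ` corner" by blast
  qed
qed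

text \<open>The left edge is the union of its copies under \<open>f\<^sub>1\<close> and \<open>f\<^sub>2\<close>, and the top edge is the union
  of its copies under \<open>f\<^sub>2, f\<^sub>3, f\<^sub>4, f\<^sub>5\<close>.\<close>

lemma corner_subset_attractor: "corner \<subseteq> attractor"
proof -
  have "corner \<subseteq> (\<Union>f\<in>IFS. f ` corner)"
  proof
    fix z assume "z \<in> corner"
    then consider "Re z = 0" "0 \<le> Im z" "Im z \<le> 2/3" | "Re z = 0" "2/3 \<le> Im z" "Im z \<le> 1"
      | "Im z = 1" "0 \<le> Re z" "Re z \<le> 1/3" | "Im z = 1" "1/3 \<le> Re z" "Re z \<le> 2/3"
      | "Im z = 1" "2/3 \<le> Re z" "Re z \<le> 5/6" | "Im z = 1" "5/6 \<le> Re z" "Re z \<le> 1"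
      unfolding mem_corner_iff by linarith
    then have "z \<in> homothety (2/3) 0 0 ` corner \<or> z \<in> homothety (1/3) 0 (2/3) ` corner \<or>
        z \<in> homothety (1/3) (1/3) (2/3) ` corner \<or> z \<in> homothety (1/6) (2/3) (5/6) ` corner \<or>
        z \<in> homothety (1/6) (5/6) (5/6) ` corner"
      by cases (simp_all add: homothety_image_corner)
    then show "z \<in> (\<Union>f\<in>IFS. f ` corner)"
      unfolding IFS_eq glued_maps_def right_maps_def by blast
  qed
  moreover have "bounded corner" by (simp add: corner_def)
  ultimately have "corner \<subseteq> closure attractor"
    using IFS_contraction attractor_nonempty IFS_image_attractor
    by (intro self_covered_subset_closure_invariant[of "2/3" IFS]) auto
  then show ?thesis by (simp add: compact_imp_closed compact_attractor)
qed

definition hub :: "complex set" where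
  "hub = connected_component_set attractor \<i>"

lemma closed_hub: "closed hub"
  unfolding hub_def
  by (rule closed_connected_component) (rule compact_imp_closed[OF compact_attractor])

lemma connected_meeting_hub_subset:
  assumes "connected K" "K \<subseteq> attractor" "z \<in> K" "z \<in> hub"
  shows "K \<subseteq> hub"
  using assms connected_component_maximal[of z K attractor] connected_component_eq
  unfolding hub_def by metis

lemma corner_subset_hub: "corner \<subseteq> hub"
  unfolding hub_def
  by (rule connected_component_maximal)
    (auto simp: connected_corner corner_subset_attractor, simp add: mem_corner_iff)

lemma connected_IFS_image_corner:
  assumes "f \<in> IFS"
  shows "connected (f ` corner)" "f ` corner \<subseteq> attractor"
  using assms connected_corner corner_subset_attractor IFS_image_attractor
  by (auto intro: connected_continuous_image continuous_on_IFS)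

lemma IFS_image_corner_subset_hub:
  assumes f: "f \<in> IFS" and not7: "f \<noteq> homothety (1/12) (11/12) (17/24)"
  shows "f ` corner \<subseteq> hub"
proof -
  have meets: "g ` corner \<subseteq> hub" if "g \<in> IFS" "g z \<in> hub" "z \<in> corner" for g z
    using that by (intro connected_meeting_hub_subset[of _ "g z"] connected_IFS_image_corner) auto
  have "\<i> \<in> corner" "0 \<in> corner" by (auto simp: mem_corner_iff)
  have f1: "homothety (2/3) 0 0 ` corner \<subseteq> hub"
  proof (rule meets)
    show "homothety (2/3) 0 0 0 \<in> hub"
      using corner_subset_hub by (auto simp: mem_corner_iff)
  qed (use \<open>0 \<in> corner\<close> in \<open>auto simp: IFS_eq glued_maps_def\<close>)
  \<comment> \<open>The point \<open>f\<^sub>k(\<i>)\<close> lies on \<open>corner\<close>, except for \<open>k = 6\<close>, where it is the end point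
    \<open>f\<^sub>1(1 + \<i>)\<close> of \<open>f\<^sub>1(corner)\<close>.\<close>
  have "f \<i> \<in> corner \<or> f \<i> \<in> homothety (2/3) 0 0 ` corner"
    using f not7 unfolding IFS_eq glued_maps_def right_maps_def
    by (auto simp: homothety_image_corner) (auto simp: mem_corner_iff)
  then show ?thesis
    using f1 meets[OF f _ \<open>\<i> \<in> corner\<close>] corner_subset_hub by blast
qed

text \<open>The segments \<open>f\<^sub>1(L)\<close>, \<open>f\<^sub>2(L)\<close>, \<open>f\<^sub>3(L)\<close>, \<open>f\<^sub>4(L)\<close> lie on the left edges of the copies of the
  unit square under \<open>f\<^sub>6\<close>, \<open>f\<^sub>3\<close>, \<open>f\<^sub>4\<close>, \<open>f\<^sub>5\<close>.\<close>

lemma glued_image_L_subset_hub: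
  assumes "f \<in> glued_maps"
  shows "f ` L \<subseteq> hub"
proof -
  define G where "G = {homothety (1/3) (2/3) (1/3), homothety (1/3) (1/3) (2/3),
    homothety (1/6) (2/3) (5/6), homothety (1/6) (5/6) (5/6)}"
  have "g ` corner \<subseteq> hub" if "g \<in> G" for g
  proof (rule IFS_image_corner_subset_hub)
    show "g \<in> IFS" using that by (auto simp: G_def IFS_eq glued_maps_def right_maps_def)
    \<comment> \<open>The value at \<open>0\<close> tells the maps in \<open>G\<close> from \<open>f\<^sub>7\<close>, whose real part there is \<open>11/12\<close>.\<close>
    have "Re (g 0) < 11/12" using that by (auto simp: G_def)
    then show "g \<noteq> homothety (1/12) (11/12) (17/24)" by auto
  qed
  moreover have "homothety (2/3) 0 0 ` L \<subseteq> homothety (1/3) (2/3) (1/3) ` corner"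
    "homothety (1/3) 0 (2/3) ` L \<subseteq> homothety (1/3) (1/3) (2/3) ` corner"
    "homothety (1/3) (1/3) (2/3) ` L \<subseteq> homothety (1/6) (2/3) (5/6) ` corner"
    "homothety (1/6) (2/3) (5/6) ` L \<subseteq> homothety (1/6) (5/6) (5/6) ` corner"
    by (auto simp: homothety_image_corner mem_L_iff)
  then have "\<exists>g\<in>G. f ` L \<subseteq> g ` corner"
    using assms unfolding glued_maps_def G_def insert_iff empty_iff bex_simps
    by (elim disjE) simp_all
  ultimately show ?thesis by blast
qed

section \<open>Density of the points joined to the corner or to the segment\<close>

lemma IFS_image_connected_component_subset:
  assumes "f \<in> IFS" "z \<in> attractor"
  shows "f ` connected_component_set attractor z \<subseteq> connected_component_set attractor (f z)"
proof (rule connected_component_maximal)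
  show "f z \<in> f ` connected_component_set attractor z"
    using assms(2) by (auto simp: connected_component_refl)
  show "connected (f ` connected_component_set attractor z)"
    by (rule connected_continuous_image[OF continuous_on_IFS[OF assms(1)]]) simp
  show "f ` connected_component_set attractor z \<subseteq> attractor"
    using IFS_image_attractor[OF assms(1)] connected_component_subset by blast
qed

definition anchored :: "complex set" where
  "anchored = {z \<in> attractor. connected_component_set attractor z \<inter> (corner \<union> L) \<noteq> {}}"

lemma hub_subset_anchored: "hub \<subseteq> anchored"
proof
  fix z assume z: "z \<in> hub"
  then have "z \<in> attractor" using connected_component_subset by (auto simp: hub_def)
  moreover have "connected_component_set attractor z = hub"
    using z connected_component_eq by (metis hub_def)
  moreover have "\<i> \<in> corner" by (simp add: mem_corner_iff)
  ultimately show "z \<in> anchored" using corner_subset_hub by (auto simp: anchored_def)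
qed

lemma glued_image_anchored_subset_hub:
  assumes f: "f \<in> glued_maps"
  shows "f ` anchored \<subseteq> hub"
proof
  fix w assume "w \<in> f ` anchored"
  then obtain z p where z: "z \<in> attractor" "w = f z"
    and p: "p \<in> connected_component_set attractor z" "p \<in> corner \<union> L"
    by (auto simp: anchored_def)
  have "f \<in> IFS" using f by (simp add: IFS_eq)
  \<comment> \<open>As above, \<open>f\<close> differs from \<open>f\<^sub>7\<close> at \<open>0\<close>.\<close>
  have "Re (f 0) < 11/12" using f by (auto simp: glued_maps_def)
  then have "f \<noteq> homothety (1/12) (11/12) (17/24)" by auto
  then have "f p \<in> hub"
    using p(2) IFS_image_corner_subset_hub[OF \<open>f \<in> IFS\<close>] glued_image_L_subset_hub[OF f] by blast
  moreover have "f p \<in> connected_component_set attractor w"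
    using IFS_image_connected_component_subset[OF \<open>f \<in> IFS\<close> z(1)] p(1) z(2) by blast
  ultimately show "w \<in> hub"
    unfolding hub_def by (metis connected_component_sym connected_component_trans mem_Collect_eq)
qed

lemma IFS_image_anchored_subset:
  assumes f: "f \<in> IFS"
  shows "f ` anchored \<subseteq> anchored"
proof (cases "f \<in> glued_maps")
  case True
  then show ?thesis using glued_image_anchored_subset_hub hub_subset_anchored by blast
next
  case False
  then have right: "f \<in> right_maps" using f by (simp add: IFS_eq)
  show ?thesis
  proof
    fix w assume "w \<in> f ` anchored"
    then obtain z p where z: "z \<in> attractor" "w = f z"
      and p: "p \<in> connected_component_set attractor z" "p \<in> corner \<union> L"
      by (auto simp: anchored_def)
    have w: "w \<in> attractor" using IFS_image_attractor[OF f] z by blast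
    have fp: "f p \<in> connected_component_set attractor w"
      using IFS_image_connected_component_subset[OF f z(1)] p(1) z(2) by blast
    \<comment> \<open>All three maps send the end point \<open>1 + \<i>\<close> of \<open>corner\<close> to a point of \<open>L\<close>; so a point
      joined to \<open>corner\<close> is sent to one joined to \<open>L\<close>.\<close>
    have "\<exists>q \<in> L. q \<in> connected_component_set attractor w"
    proof (cases "p \<in> L")
      case True
      then show ?thesis using fp right_maps_preserve_L[OF right] by blast
    next
      case False
      then have "f p \<in> f ` corner" using p(2) by blast
      moreover have "f (1 + \<i>) \<in> f ` corner" by (auto simp: mem_corner_iff)
      ultimately have "connected_component attractor (f p) (f (1 + \<i>))"
        using connected_IFS_image_corner[OF f] by (auto simp: connected_component_def)
      then have "f (1 + \<i>) \<in> connected_component_set attractor w"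
        using fp by (auto intro: connected_component_trans)
      moreover have "1 + \<i> \<in> L" by (simp add: mem_L_iff)
      then have "f (1 + \<i>) \<in> L" using right_maps_preserve_L[OF right] by blast
      ultimately show ?thesis by blast
    qed
    then show "w \<in> anchored" using w by (auto simp: anchored_def)
  qed
qed

text \<open>The attractor is covered by its images, and \<open>anchored\<close> is preserved by every map; this is
  where \<open>f\<^sub>7\<close>, whose copy of the corner misses the hub, stops being an obstacle.\<close>

lemma attractor_subset_closure_anchored: "attractor \<subseteq> closure anchored"
proof (rule self_covered_subset_closure_invariant[of "2/3" IFS])
  have "\<i> \<in> corner" by (simp add: mem_corner_iff)
  then show "anchored \<noteq> {}" using hub_subset_anchored corner_subset_hub by blast
  show "attractor \<subseteq> (\<Union>f\<in>IFS. f ` attractor)" using attractor_eq by blast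
  show "bounded attractor" by (rule compact_imp_bounded[OF compact_attractor])
  show "dist (f x) (f y) \<le> 2/3 * dist x y" if "f \<in> IFS" for f x y
    using that by (rule IFS_contraction)
  show "f ` anchored \<subseteq> anchored" if "f \<in> IFS" for f
    using that by (rule IFS_image_anchored_subset)
qed auto

lemma glued_image_subset_hub:
  assumes f: "f \<in> glued_maps"
  shows "f ` attractor \<subseteq> hub"
proof -
  have "f ` closure anchored \<subseteq> closure (f ` anchored)"
    using f by (intro image_closure_subset continuous_on_IFS)
      (auto simp: IFS_eq intro: subsetD[OF closure_subset])
  also have "\<dots> \<subseteq> hub"
    using glued_image_anchored_subset_hub[OF f] closed_hub by (rule closure_minimal)
  finally show ?thesis using attractor_subset_closure_anchored by blast
qed

section \<open>Trivial points\<close>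

lemma not_trivial_point_hub:
  assumes "x \<in> hub"
  shows "\<not> trivial_point attractor x"
proof
  assume "trivial_point attractor x"
  then have "hub = {x}"
    using assms connected_component_eq unfolding hub_def trivial_point_def by metis
  moreover have "0 \<in> hub" "\<i> \<in> hub" using corner_subset_hub by (auto simp: mem_corner_iff)
  ultimately show False by (metis complex_i_not_zero singletonD)
qed

lemma trivial_point_preimage:
  assumes f: "f \<in> IFS" and y: "y \<in> attractor" and triv: "trivial_point attractor (f y)"
  shows "trivial_point attractor y"
proof -
  have "f ` connected_component_set attractor y \<subseteq> {f y}"
    using IFS_image_connected_component_subset[OF f y] triv by (simp add: trivial_point_def)
  then have "connected_component_set attractor y \<subseteq> {y}"
    using inj_IFS[OF f] by (auto dest: injD)
  moreover have "y \<in> connected_component_set attractor y"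
    using y by (simp add: connected_component_refl)
  ultimately show ?thesis using y unfolding trivial_point_def by blast
qed

theorem theorem6p1:
  fixes x :: complex
  assumes "trivial_point (self_similar_set IFS) x"
  shows "x \<in> L"
proof -
  let ?Triv = "{x. trivial_point attractor x}"
  have "?Triv \<subseteq> closure L"
  proof (rule self_covered_subset_closure_invariant[of "2/3" right_maps])
    show "?Triv \<subseteq> (\<Union>f\<in>right_maps. f ` ?Triv)"
    proof
      fix x assume x: "x \<in> ?Triv"
      then have "x \<in> attractor" by (simp add: trivial_point_def)
      then obtain f y where fy: "f \<in> IFS" "y \<in> attractor" "x = f y"
        using attractor_eq by blast
      then have "y \<in> ?Triv" using x trivial_point_preimage by simp
      moreover have "f \<notin> glued_maps"
        using x fy(2,3) glued_image_subset_hub not_trivial_point_hub by blast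
      ultimately show "x \<in> (\<Union>f\<in>right_maps. f ` ?Triv)" using fy by (auto simp: IFS_eq)
    qed
    have "?Triv \<subseteq> attractor" by (auto simp: trivial_point_def)
    then show "bounded ?Triv"
      using compact_imp_bounded[OF compact_attractor] bounded_subset by blast
    show "dist (f x) (f y) \<le> 2/3 * dist x y" if "f \<in> right_maps" for f x y
      using that by (intro IFS_contraction) (simp add: IFS_eq)
    show "f ` L \<subseteq> L" if "f \<in> right_maps" for f using that by (rule right_maps_preserve_L)
    have "Complex 1 1 \<in> L" by (simp add: mem_L_iff)
    then show "L \<noteq> {}" by blast
  qed auto
  then show ?thesis using assms by (simp add: L_eq_cbox subset_iff)
qed

end
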